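(* Let $(L,\vee,\wedge,0,1)$ be a non-trivial complete lattice, let $(T,R)$ be a time frame with serial relation $R$, let $P,F,H,G\colon L^T\to L^T$ denote the tense operators induced by $(T,R)$, and let $p,q\in L^T$. Then the following hold: (i) $P(0)=F(0)=H(0)=G(0)=0$ and $P(1)=F(1)=H(1)=G(1)=1$; (ii) $p\leq q$ implies $P(p)\leq P(q)$, $F(p)\leq F(q)$, $H(p)\leq H(q)$ and $G(p)\leq G(q)$; (iii) $P(G(q))\leq q\leq G(P(q))$ and $F(H(q))\leq q\leq H(F(q))$.
   Context: A time frame is a pair $(T,R)$ consisting of a non-empty set $T$ and a non-empty binary relation $R\subseteq T\times T$; $s\mathrel R t$ means $(s,t)\in R$. The relation $R$ is serial if for each $s\in T$ there exist $t,u\in T$ with $t\mathrel R s$ and $s\mathrel R u$. Here $0$ and $1$ are the least and greatest elements of $L$; non-trivial means that $L$ has more than one element. $L^T$ is the set of all functions $T\to L$, ordered pointwise; in $L^T$ the symbols $0$ and $1$ denote the constant functions with values $0$ and $1$. The tense operators $P,F,H,G\colon L^T\to L^T$ induced by $(T,R)$ are defined, for $q\in L^T$ and $s\in T$, by $P(q)(s):=\bigvee\{q(t)\mid t\mathrel R s\}$, $F(q)(s):=\bigvee\{q(t)\mid s\mathrel R t\}$, $H(q)(s):=\bigwedge\{q(t)\mid t\mathrel R s\}$, $G(q)(s):=\bigwedge\{q(t)\mid s\mathrel R t\}$. *)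

theory Defs
  imports Main
begin

text \<open>
  The set of times is the universe of a type \<open>'t\<close> (non-empty, like every HOL type), so
  \<open>R \<subseteq> T \<times> T\<close> holds automatically and \<open>L^T\<close> is the function type \<open>'t \<Rightarrow> 'l\<close>
  with the pointwise order of the library.
\<close>

definition time_frame :: "('t \<times> 't) set \<Rightarrow> bool" where
  "time_frame R \<longleftrightarrow> R \<noteq> {}"

text \<open>Seriality is required in both directions: every time has a predecessor and a successor.\<close>

definition serial :: "('t \<times> 't) set \<Rightarrow> bool" where
  "serial R \<longleftrightarrow> (\<forall>s. \<exists>t u. (t, s) \<in> R \<and> (s, u) \<in> R)"

definition tense_P :: "('t \<times> 't) set \<Rightarrow> ('t \<Rightarrow> 'l::complete_lattice) \<Rightarrow> 't \<Rightarrow> 'l" where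
  "tense_P R q s = Sup {q t | t. (t, s) \<in> R}"

definition tense_F :: "('t \<times> 't) set \<Rightarrow> ('t \<Rightarrow> 'l::complete_lattice) \<Rightarrow> 't \<Rightarrow> 'l" where
  "tense_F R q s = Sup {q t | t. (s, t) \<in> R}"

definition tense_H :: "('t \<times> 't) set \<Rightarrow> ('t \<Rightarrow> 'l::complete_lattice) \<Rightarrow> 't \<Rightarrow> 'l" where
  "tense_H R q s = Inf {q t | t. (t, s) \<in> R}"

definition tense_G :: "('t \<times> 't) set \<Rightarrow> ('t \<Rightarrow> 'l::complete_lattice) \<Rightarrow> 't \<Rightarrow> 'l" where
  "tense_G R q s = Inf {q t | t. (s, t) \<in> R}"

end

theory Submission
  imports Defs
begin

text \<open>
  \<open>P\<close> is lower adjoint to \<open>G\<close>, and \<open>F\<close> to \<open>H\<close>, which gives (ii) and (iii); seriality makes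
  all the joins and meets non-empty, so that constant functions are fixed.
\<close>

text \<open>Reversing time swaps past and future, so facts about \<open>tense_P\<close> and
  \<open>tense_G\<close> for arbitrary relations also cover \<open>tense_F\<close> and
  \<open>tense_H\<close>.\<close>

lemma tense_F_converse: "tense_F R = tense_P (R\<inverse>)"
  by (simp add: fun_eq_iff tense_F_def tense_P_def)

lemma tense_H_converse: "tense_H R = tense_G (R\<inverse>)"
  by (simp add: fun_eq_iff tense_H_def tense_G_def)

lemma serial_converse: "serial R \<Longrightarrow> serial (R\<inverse>)"
  unfolding serial_def by blast

lemma tense_P_const:
  assumes "serial R"
  shows "tense_P R (\<lambda>_. c) = (\<lambda>_. c)"
proof
  fix s
  \<comment> \<open>A predecessor of \<open>s\<close> is essential here: the empty join would be
    \<open>bot\<close> instead of \<open>c\<close>.\<close>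
  have "{c | t. (t, s) \<in> R} = {c}"
    using assms by (auto simp: serial_def)
  then show "tense_P R (\<lambda>_. c) s = c"
    by (simp add: tense_P_def)
qed

lemma tense_G_const:
  assumes "serial R"
  shows "tense_G R (\<lambda>_. c) = (\<lambda>_. c)"
proof
  fix s
  have "{c | t. (s, t) \<in> R} = {c}"
    using assms by (auto simp: serial_def)
  then show "tense_G R (\<lambda>_. c) s = c"
    by (simp add: tense_G_def)
qed

text \<open>Both sides unfold to \<open>p t \<le> q s\<close> for all \<open>(t, s) \<in> R\<close>;
  seriality does not enter.\<close>

lemma tense_P_le_iff_le_tense_G: "tense_P R p \<le> q \<longleftrightarrow> p \<le> tense_G R q"
  by (auto simp: le_fun_def tense_P_def tense_G_def Sup_le_iff le_Inf_iff)

lemma tense_P_tense_G_le: "tense_P R (tense_G R q) \<le> q"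
  by (simp add: tense_P_le_iff_le_tense_G)

lemma le_tense_G_tense_P: "q \<le> tense_G R (tense_P R q)"
  by (simp flip: tense_P_le_iff_le_tense_G)

text \<open>By adjointness the claim becomes \<open>p \<le> tense_G R (tense_P R q)\<close>, and
  \<open>q\<close> lies in between.\<close>

lemma tense_P_mono: "p \<le> q \<Longrightarrow> tense_P R p \<le> tense_P R q"
  using le_tense_G_tense_P by (auto simp: tense_P_le_iff_le_tense_G intro: order_trans)

lemma tense_G_mono: "p \<le> q \<Longrightarrow> tense_G R p \<le> tense_G R q"
  using tense_P_tense_G_le by (auto simp flip: tense_P_le_iff_le_tense_G intro: order_trans)

theorem theorem3p1:
  fixes R :: "('t \<times> 't) set"
    and p q :: "'t \<Rightarrow> 'l::complete_lattice"
  assumes nontrivial: "\<exists>x y :: 'l. x \<noteq> y"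
    and frame: "time_frame R"
    and serial: "serial R"
  shows
    "(tense_P R (\<lambda>_. bot :: 'l) = (\<lambda>_. bot) \<and> tense_F R (\<lambda>_. bot :: 'l) = (\<lambda>_. bot) \<and>
      tense_H R (\<lambda>_. bot :: 'l) = (\<lambda>_. bot) \<and> tense_G R (\<lambda>_. bot :: 'l) = (\<lambda>_. bot) \<and>
      tense_P R (\<lambda>_. top :: 'l) = (\<lambda>_. top) \<and> tense_F R (\<lambda>_. top :: 'l) = (\<lambda>_. top) \<and>
      tense_H R (\<lambda>_. top :: 'l) = (\<lambda>_. top) \<and> tense_G R (\<lambda>_. top :: 'l) = (\<lambda>_. top)) \<and>
     (p \<le> q \<longrightarrow>
        tense_P R p \<le> tense_P R q \<and> tense_F R p \<le> tense_F R q \<and>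
        tense_H R p \<le> tense_H R q \<and> tense_G R p \<le> tense_G R q) \<and>
     (tense_P R (tense_G R q) \<le> q \<and> q \<le> tense_G R (tense_P R q) \<and>
      tense_F R (tense_H R q) \<le> q \<and> q \<le> tense_H R (tense_F R q))"
  \<comment> \<open>The second fact lets the lemmas on constants apply to
    \<open>R\<inverse>\<close>, that is, to \<open>tense_F\<close> and
    \<open>tense_H\<close>.\<close>
  using serial serial_converse[OF serial]
  by (simp add: tense_F_converse tense_H_converse tense_P_const tense_G_const
      tense_P_mono tense_G_mono tense_P_tense_G_le le_tense_G_tense_P)

end
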